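(* Let $G$ be a finite group. Then the set of superclasses of the finest normal supercharacter theory of $G$ is $\{K_g: g\in G\}$; that is, $$\{N^\circ\neq\emptyset : N\in N(G)\}=\{K_g:g\in G\}.$$
   Context: $\mathrm{Irr}(G)$ is the set of irreducible complex characters of $G$, and $N(G)$ is the set of all normal subgroups of the finite group $G$. For $N\in N(G)$, $N^\circ:=N\setminus\bigcup_{H\in N(G),\,H\subset N}H$, where $\subset$ is strict inclusion. The finest normal supercharacter theory of $G$ is the one generated by the set of all normal subgroups of $G$; its superclasses are, by definition, the nonempty sets $N^\circ$, $N\in N(G)$. For $\chi\in\mathrm{Irr}(G)$ let $e_\chi=\frac{\chi(1)}{|G|}\sum_{g\in G}\chi(g^{-1})g\in\mathbb{C}G$ be the corresponding primitive central idempotent. $C_g$ denotes the conjugacy class of $g\in G$. For $g\in G$, $$E_g:=\left\{e_{\chi}: \chi\in\mathrm{Irr}(G),\ 1-\tfrac{\chi(g)}{\chi(1)}\neq 0\right\},\qquad K_g:=\bigcup_{h\in G:\,E_h=E_g}C_h .$$ *)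

theory Defs
  imports "HOL-Algebra.Group_Action" "Jordan_Normal_Form.VS_Connect"
begin

text \<open>
  Complex representations are homomorphisms from \<open>G\<close> to the unit group of the ring of complex
  \<open>n \<times> n\<close> matrices, i.e. to \<open>GL\<^sub>n(\<complex>)\<close>.
\<close>

definition representation :: "('a, 'b) monoid_scheme \<Rightarrow> nat \<Rightarrow> ('a \<Rightarrow> complex mat) \<Rightarrow> bool"
  where "representation G n \<rho> \<longleftrightarrow> \<rho> \<in> hom G (units_of (ring_mat TYPE(complex) n ()))"

definition irreducible_representation ::
    "('a, 'b) monoid_scheme \<Rightarrow> nat \<Rightarrow> ('a \<Rightarrow> complex mat) \<Rightarrow> bool"
  where "irreducible_representation G n \<rho> \<longleftrightarrow>
    representation G n \<rho> \<and> n \<noteq> 0 \<and>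
    (\<forall>W. VectorSpace.subspace class_ring W (module_vec TYPE(complex) n) \<and>
         (\<forall>g\<in>carrier G. \<forall>w\<in>W. \<rho> g *\<^sub>v w \<in> W)
       \<longrightarrow> W = {0\<^sub>v n} \<or> W = carrier_vec n)"

definition mat_trace :: "complex mat \<Rightarrow> complex"
  where "mat_trace A = (\<Sum>i<dim_row A. A $$ (i, i))"

text \<open>
  Functions on \<open>G\<close> are restricted to \<open>carrier G\<close> (value \<open>undefined\<close> elsewhere), so that
  equality of functions is equality on the group.
\<close>

definition character :: "('a, 'b) monoid_scheme \<Rightarrow> ('a \<Rightarrow> complex mat) \<Rightarrow> 'a \<Rightarrow> complex"
  where "character G \<rho> = (\<lambda>g\<in>carrier G. mat_trace (\<rho> g))"

definition Irr :: "('a, 'b) monoid_scheme \<Rightarrow> ('a \<Rightarrow> complex) set"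
  where "Irr G = {character G \<rho> | n \<rho>. irreducible_representation G n \<rho>}"

text \<open>
  An element of the group algebra \<open>\<complex>G\<close> is represented by its coefficient function: the function
  \<open>a\<close> stands for the formal sum of all \<open>a(g) g\<close>. Thus the value at \<open>g\<close> of the following function
  is the coefficient of \<open>g\<close> in the idempotent belonging to \<open>\<chi>\<close>.
\<close>

definition central_idempotent ::
    "('a, 'b) monoid_scheme \<Rightarrow> ('a \<Rightarrow> complex) \<Rightarrow> 'a \<Rightarrow> complex"
  where "central_idempotent G \<chi> =
    (\<lambda>g\<in>carrier G. \<chi> \<one>\<^bsub>G\<^esub> / of_nat (Coset.order G) * \<chi> (inv\<^bsub>G\<^esub> g))"

definition conjugacy_class :: "('a, 'b) monoid_scheme \<Rightarrow> 'a \<Rightarrow> 'a set"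
  where "conjugacy_class G g =
    orbit G (\<lambda>x. \<lambda>h\<in>carrier G. x \<otimes>\<^bsub>G\<^esub> h \<otimes>\<^bsub>G\<^esub> inv\<^bsub>G\<^esub> x) g"

definition E_set :: "('a, 'b) monoid_scheme \<Rightarrow> 'a \<Rightarrow> ('a \<Rightarrow> complex) set"
  where "E_set G g =
    {central_idempotent G \<chi> | \<chi>. \<chi> \<in> Irr G \<and> 1 - \<chi> g / \<chi> \<one>\<^bsub>G\<^esub> \<noteq> 0}"

definition K_set :: "('a, 'b) monoid_scheme \<Rightarrow> 'a \<Rightarrow> 'a set"
  where "K_set G g = \<Union> {conjugacy_class G h | h. h \<in> carrier G \<and> E_set G h = E_set G g}"

definition normal_subgroups :: "('a, 'b) monoid_scheme \<Rightarrow> 'a set set"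
  where "normal_subgroups G = {N. N \<lhd> G}"

definition normal_interior :: "('a, 'b) monoid_scheme \<Rightarrow> 'a set \<Rightarrow> 'a set"
  where "normal_interior G N = N - \<Union> {H \<in> normal_subgroups G. H \<subset> N}"

definition finest_normal_superclasses :: "('a, 'b) monoid_scheme \<Rightarrow> 'a set set"
  where "finest_normal_superclasses G =
    {normal_interior G N | N. N \<in> normal_subgroups G \<and> normal_interior G N \<noteq> {}}"

end

theory Submission
  imports Defs "HOL-Algebra.Multiplicative_Group" "Jordan_Normal_Form.Jordan_Normal_Form_Existence"
begin

text \<open>
  An element \<open>g\<close> lies in \<open>N\<^sup>\<circ>\<close> iff \<open>N\<close> is the normal closure of \<open>g\<close>, so the superclasses are the
  fibres of \<open>g \<mapsto> normal_closure G g\<close>. On the other hand \<open>E_set G g\<close> records which irreducible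
  characters have \<open>g\<close> outside their kernel: \<open>\<chi>(g) = \<chi>(1)\<close> iff \<open>\<rho>(g) = 1\<close>, because \<open>\<rho>(g)\<close> has finite
  order, hence is diagonalizable with roots of unity as eigenvalues. The two invariants agree once
  every normal subgroup is an intersection of kernels of irreducible representations. For the
  latter, start from the regular representation of \<open>G/N\<close> and pass to sub- or quotient
  representations on which \<open>h \<notin> N\<close> still acts nontrivially. One of the two always qualifies, since a
  unipotent matrix of finite order is trivial; no complete reducibility is needed.
\<close>

section \<open>Complex matrices of finite order\<close>

lemma mat_trace_mult_comm:
  assumes "A \<in> carrier_mat n m" and "B \<in> carrier_mat m n"
  shows "mat_trace (A * B) = mat_trace (B * A)"
proof -
  have "mat_trace (A * B) = (\<Sum>i<n. \<Sum>j<m. A $$ (i, j) * B $$ (j, i))"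
    using assms by (auto simp: mat_trace_def scalar_prod_def atLeast0LessThan intro!: sum.cong)
  also have "\<dots> = (\<Sum>j<m. \<Sum>i<n. B $$ (j, i) * A $$ (i, j))"
    by (subst sum.swap) (simp add: mult.commute)
  also have "\<dots> = mat_trace (B * A)"
    using assms by (auto simp: mat_trace_def scalar_prod_def atLeast0LessThan intro!: sum.cong)
  finally show ?thesis .
qed

lemma mat_trace_similar:
  assumes "similar_mat A B"
  shows "mat_trace A = mat_trace B"
proof -
  obtain P Q where PQ: "similar_mat_wit A B P Q"
    using assms by (auto simp: similar_mat_def)
  define n where "n = dim_row A"
  note D = similar_mat_witD[OF n_def PQ]
  have "mat_trace A = mat_trace (P * (B * Q))"
    unfolding D(3) using D(5-7) by simp
  also have "\<dots> = mat_trace (B * Q * P)"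
    by (rule mat_trace_mult_comm[of _ n n]) (use D(5-7) in auto)
  also have "B * Q * P = B"
    using D(2,5-7) by simp
  finally show ?thesis .
qed

section \<open>Powers and traces of Jordan matrices\<close>

lemma jordan_matrix_Cons:
  "jordan_matrix ((k, a) # n_as) =
    four_block_mat (jordan_block k a) (0\<^sub>m k (sum_list (map fst n_as)))
      (0\<^sub>m (sum_list (map fst n_as)) k) (jordan_matrix n_as)"
  using jordan_matrix_dim[of n_as] by (simp add: jordan_matrix_def Let_def)

lemma four_block_mat_one_iff:
  assumes "A \<in> carrier_mat n n" "B \<in> carrier_mat n m" "C \<in> carrier_mat m n" "D \<in> carrier_mat m m"
  shows "four_block_mat A B C D = 1\<^sub>m (n + m) \<longleftrightarrow>
    A = 1\<^sub>m n \<and> B = 0\<^sub>m n m \<and> C = 0\<^sub>m m n \<and> D = 1\<^sub>m m"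
proof
  assume eq: "four_block_mat A B C D = 1\<^sub>m (n + m)"
  have ent: "four_block_mat A B C D $$ (i, j) = (if i = j then 1 else 0)"
    if "i < n + m" "j < n + m" for i j
    using that by (simp add: eq)
  have "A = 1\<^sub>m n"
  proof (rule eq_matI)
    fix i j assume "i < dim_row (1\<^sub>m n :: 'a mat)" "j < dim_col (1\<^sub>m n :: 'a mat)"
    then show "A $$ (i, j) = 1\<^sub>m n $$ (i, j)"
      using ent[of i j] assms by auto
  qed (use assms in auto)
  moreover have "B = 0\<^sub>m n m"
  proof (rule eq_matI)
    fix i j assume "i < dim_row (0\<^sub>m n m :: 'a mat)" "j < dim_col (0\<^sub>m n m :: 'a mat)"
    then show "B $$ (i, j) = 0\<^sub>m n m $$ (i, j)"
      using ent[of i "n + j"] assms by auto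
  qed (use assms in auto)
  moreover have "C = 0\<^sub>m m n"
  proof (rule eq_matI)
    fix i j assume "i < dim_row (0\<^sub>m m n :: 'a mat)" "j < dim_col (0\<^sub>m m n :: 'a mat)"
    then show "C $$ (i, j) = 0\<^sub>m m n $$ (i, j)"
      using ent[of "n + i" j] assms by auto
  qed (use assms in auto)
  moreover have "D = 1\<^sub>m m"
  proof (rule eq_matI)
    fix i j assume "i < dim_row (1\<^sub>m m :: 'a mat)" "j < dim_col (1\<^sub>m m :: 'a mat)"
    then show "D $$ (i, j) = 1\<^sub>m m $$ (i, j)"
      using ent[of "n + i" "n + j"] assms by auto
  qed (use assms in auto)
  ultimately show "A = 1\<^sub>m n \<and> B = 0\<^sub>m n m \<and> C = 0\<^sub>m m n \<and> D = 1\<^sub>m m" by blast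
qed auto

text \<open>In a block of size at least 2, the \<open>m\<close>-th power has the entry
  \<open>m * a ^ (m - 1)\<close> at position \<open>(0, 1)\<close>. Since \<open>a ^ m = 1\<close>
  forces \<open>a\<close> to be nonzero, this entry is nonzero in characteristic 0, so only blocks
  of size 1 can have finite order.\<close>

lemma jordan_block_pow_eq_one:
  fixes a :: complex
  assumes "jordan_block k a ^\<^sub>m m = 1\<^sub>m k" "0 < m" "0 < k"
  shows "k = 1 \<and> a ^ m = 1"
proof -
  have ent: "(jordan_block k a ^\<^sub>m m) $$ (i, j) = (if i = j then 1 else 0)" if "i < k" "j < k" for i j
    using that by (simp add: assms(1))
  have am: "a ^ m = 1"
    using ent[of 0 0] assms(3) by (simp add: jordan_block_pow)
  moreover have "\<not> 1 < k"
  proof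
    assume "1 < k"
    then have "of_nat m * a ^ (m - 1) = 0"
      using ent[of 0 1] by (simp add: jordan_block_pow)
    with am assms(2) show False by (auto simp: power_0_left)
  qed
  ultimately show ?thesis using assms(3) by auto
qed

text \<open>Powers of a block diagonal matrix are taken block by block, which reduces the claim to a
  single Jordan block. Empty blocks are excluded because their eigenvalue label is
  arbitrary.\<close>

lemma jordan_matrix_pow_eq_one:
  fixes n_as :: "(nat \<times> complex) list"
  assumes "jordan_matrix n_as ^\<^sub>m m = 1\<^sub>m (sum_list (map fst n_as))" "0 < m" "0 \<notin> fst ` set n_as"
  shows "\<forall>(k, a) \<in> set n_as. k = 1 \<and> a ^ m = 1"
  using assms
proof (induction n_as)
  case (Cons x n_as)
  obtain k a where x: "x = (k, a)" by force
  let ?r = "sum_list (map fst n_as)"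
  have "four_block_mat (jordan_block k a ^\<^sub>m m) (0\<^sub>m k ?r) (0\<^sub>m ?r k) (jordan_matrix n_as ^\<^sub>m m) = 1\<^sub>m (k + ?r)"
    using Cons.prems(1) unfolding x jordan_matrix_Cons by (simp add: pow_four_block_mat[of _ k _ ?r])
  then have "jordan_block k a ^\<^sub>m m = 1\<^sub>m k" "jordan_matrix n_as ^\<^sub>m m = 1\<^sub>m ?r"
    by (simp_all add: four_block_mat_one_iff pow_carrier_mat)
  with Cons x jordan_block_pow_eq_one[of k a m] show ?case by auto
qed simp

lemma mat_trace_jordan_matrix:
  "mat_trace (jordan_matrix n_as) = (\<Sum>(k, a)\<leftarrow>n_as. of_nat k * a)"
proof (induction n_as)
  case Nil
  then show ?case by (simp add: mat_trace_def jordan_matrix_def)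
next
  case (Cons x n_as)
  obtain k a where x: "x = (k, a)" by force
  let ?r = "sum_list (map fst n_as)"
  have split_sum: "(\<Sum>i<k + r. if i < k then a else f (i - k)) = (\<Sum>i<k. a) + (\<Sum>i<r. f i)"
    for k a r and f :: "nat \<Rightarrow> complex"
    by (induction r) auto
  have "mat_trace (jordan_matrix (x # n_as)) =
      (\<Sum>i<k + ?r. if i < k then a else jordan_matrix n_as $$ (i - k, i - k))"
    unfolding mat_trace_def x jordan_matrix_Cons by (auto intro!: sum.cong)
  also have "\<dots> = (\<Sum>i<k. a) + (\<Sum>i<?r. jordan_matrix n_as $$ (i, i))"
    using split_sum[of k a "\<lambda>i. jordan_matrix n_as $$ (i, i)" ?r] by simp
  finally show ?case using Cons by (simp add: x mat_trace_def)
qed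

lemma jordan_matrix_ones:
  assumes "\<forall>(k, a) \<in> set n_as. k = 1 \<and> a = 1"
  shows "jordan_matrix n_as = 1\<^sub>m (length n_as)"
  using assms
proof (induction n_as)
  case Nil
  then show ?case by (auto simp: jordan_matrix_def)
next
  case (Cons x n_as)
  have "jordan_block 1 (1::'a) = 1\<^sub>m 1" by (rule eq_matI) auto
  moreover have "sum_list (map fst n_as) = length n_as"
    using Cons.prems by (induction n_as) auto
  moreover have "x = (1, 1)" using Cons.prems by auto
  ultimately have "jordan_matrix (x # n_as) = 1\<^sub>m (1 + length n_as)"
    using Cons by (simp add: jordan_matrix_Cons del: One_nat_def plus_1_eq_Suc)
  then show ?case by simp
qed

text \<open>Equality case of the triangle inequality: each real part is at most 1, so the sum
  reaches the length only if every real part is 1, and on the unit circle this forces the number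
  itself to be 1.\<close>

lemma sum_list_unit_norm_eq_length:
  fixes zs :: "complex list"
  assumes "\<forall>z\<in>set zs. norm z = 1" "sum_list zs = of_nat (length zs)"
  shows "\<forall>z\<in>set zs. z = 1"
proof -
  have le: "Re (sum_list zs) \<le> length zs" if "\<forall>z\<in>set zs. norm z = 1" for zs :: "complex list"
    using that
  proof (induction zs)
    case (Cons z zs)
    then show ?case using complex_Re_le_cmod[of z] by auto
  qed simp
  have one: "z = 1" if "norm z = 1" "1 \<le> Re z" for z :: complex
    using that complex_Re_le_cmod[of z] by (simp add: cmod_eq_Re complex_eq_iff cmod_def)
  \<comment> \<open>An inequality between length and real part passes to the tail: removing
    \<open>z\<close> lowers the length by 1 and the real part by at most 1.\<close>
  have "\<forall>z\<in>set zs. z = 1" if "\<forall>z\<in>set zs. norm z = 1" "length zs \<le> Re (sum_list zs)" for zs :: "complex list"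
    using that
  proof (induction zs)
    case (Cons z zs)
    then have "Re z \<le> 1" "Re (sum_list zs) \<le> length zs"
      using le[of zs] complex_Re_le_cmod[of z] by auto
    with Cons one[of z] show ?case by auto
  qed simp
  with assms show ?thesis by simp
qed

text \<open>The Jordan form of \<open>A\<close> is diagonal with roots of unity on the diagonal.
  Their sum \<open>n\<close> forces all of them to be 1, so \<open>A\<close> is similar, hence
  equal, to the identity.\<close>

lemma finite_order_mat_trace:
  fixes A :: "complex mat"
  assumes A: "A \<in> carrier_mat n n" and pow: "A ^\<^sub>m m = 1\<^sub>m n" "0 < m"
    and tr: "mat_trace A = of_nat n"
  shows "A = 1\<^sub>m n"
proof -
  obtain n_as where nf: "jordan_nf A n_as"
    using char_poly_factorized[OF A] jordan_nf_exists[OF A] by blast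
  let ?J = "jordan_matrix n_as"
  obtain P Q where PQ: "similar_mat_wit A ?J P Q"
    using nf by (auto simp: jordan_nf_def similar_mat_def)
  note D = similar_mat_witD2[OF A PQ]
  have n: "sum_list (map fst n_as) = n"
    using D(5) by (metis carrier_matD(1) jordan_matrix_dim(1))
  \<comment> \<open>The similarity is read backwards, so that
    \<open>A ^\<^sub>m m = 1\<^sub>m n\<close> turns the power of \<open>?J\<close> into
    \<open>Q * P\<close>, which is the identity.\<close>
  have "similar_mat_wit (?J ^\<^sub>m m) (A ^\<^sub>m m) Q P"
    by (rule similar_mat_wit_pow[OF similar_mat_wit_sym[OF PQ]])
  then have "?J ^\<^sub>m m = 1\<^sub>m n"
    using similar_mat_witD2(1,2,3)[of "?J ^\<^sub>m m" n n "A ^\<^sub>m m" Q P] D(5,6,7) pow(1)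
    by (simp add: pow_carrier_mat)
  then have blocks: "\<forall>(k, a) \<in> set n_as. k = 1 \<and> a ^ m = 1"
    using jordan_matrix_pow_eq_one[of n_as m] n nf pow(2) by (auto simp: jordan_nf_def)
  have len: "length n_as = n"
    using blocks unfolding n[symmetric] by (induction n_as) auto
  have "mat_trace ?J = of_nat n"
    using tr mat_trace_similar[of A ?J] PQ unfolding similar_mat_def by metis
  moreover have "mat_trace ?J = sum_list (map snd n_as)"
    unfolding mat_trace_jordan_matrix using blocks by (induction n_as) auto
  moreover have "\<forall>z\<in>set (map snd n_as). norm z = 1"
  proof
    fix z assume "z \<in> set (map snd n_as)"
    then have "z ^ m = 1" using blocks by auto
    then show "norm z = 1" using pow(2) power_eq_1_iff by blast
  qed
  ultimately have "\<forall>z\<in>set (map snd n_as). z = 1"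
    using sum_list_unit_norm_eq_length[of "map snd n_as"] len by simp
  with blocks have "?J = 1\<^sub>m n"
    using jordan_matrix_ones[of n_as] len by fastforce
  with D show ?thesis by simp
qed

section \<open>Bases adapted to a subspace\<close>

text \<open>Preimages of the unit vectors are the columns of a right inverse, and a right inverse of
  a square matrix over a field is also a left inverse.\<close>

lemma surj_mat_imp_inverse:
  fixes P :: "'a :: field mat"
  assumes P: "P \<in> carrier_mat n n"
    and surj: "\<And>v. v \<in> carrier_vec n \<Longrightarrow> \<exists>c\<in>carrier_vec n. P *\<^sub>v c = v"
  shows "\<exists>Q\<in>carrier_mat n n. P * Q = 1\<^sub>m n \<and> Q * P = 1\<^sub>m n"
proof -
  have "\<forall>j. \<exists>c. c \<in> carrier_vec n \<and> P *\<^sub>v c = unit_vec n j"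
    using surj by (metis unit_vec_carrier)
  then obtain c where c: "\<And>j. c j \<in> carrier_vec n" "\<And>j. P *\<^sub>v c j = unit_vec n j"
    by metis
  define Q where "Q = mat n n (\<lambda>(i, j). c j $ i)"
  have Q: "Q \<in> carrier_mat n n" by (simp add: Q_def)
  have "P * Q = 1\<^sub>m n"
  proof (rule mat_col_eqI)
    fix j assume "j < dim_col (1\<^sub>m n :: 'a mat)"
    then have j: "j < n" by simp
    have "col Q j = c j" using c(1)[of j] j by (intro eq_vecI) (auto simp: Q_def)
    with j c(2) show "col (P * Q) j = col (1\<^sub>m n) j" by (simp add: col_mult2[OF P Q])
  qed (use P Q in auto)
  with mat_mult_left_right_inverse[OF P Q] Q show ?thesis by blast
qed

text \<open>A maximal independent subset of \<open>W\<close> spans \<open>W\<close>; a maximal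
  independent set containing it is a basis of the whole space. Both exist because the dimension
  bounds the size of independent sets. Lists fix an order, so that the basis can serve as the
  columns of a matrix.\<close>

lemma (in vec_space) extend_subspace_basis:
  assumes W: "VectorSpace.subspace class_ring W V"
  obtains xs ys where "distinct (xs @ ys)" "set xs \<subseteq> W" "W = span (set xs)"
    "basis (set (xs @ ys))"
proof -
  have WV: "W \<subseteq> carrier_vec n" using W 
    by (auto simp: VectorSpace.subspace_def submodule_def)
  have bounded: "finite S \<and> card S \<le> dim" if "S \<subseteq> carrier_vec n" "lin_indpt S" for S
    using li_le_dim[OF fin_dim that] by simp
  have "lin_indpt {}" by (simp add: lin_dep_def)
  then obtain A where A: "finite A" "maximal A (\<lambda>S. S \<subseteq> W \<and> lin_indpt S)"
    using maximal_exists[of "\<lambda>S. S \<subseteq> W \<and> lin_indpt S" dim "{}"] bounded WV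
    by blast
  then have AW: "A \<subseteq> W" and li: "lin_indpt A" and AV: "A \<subseteq> carrier_vec n"
    using WV by (auto simp: maximal_def)
  have "W \<subseteq> span A"
  proof (rule subsetI, rule ccontr)
    fix v assume v: "v \<in> W" "v \<notin> span A"
    then have "v \<notin> A" using in_own_span[OF AV] by auto
    with v WV lin_dep_iff_in_span[OF AV li] have "lin_indpt (A \<union> {v})" by blast
    with A(2) AW v \<open>v \<notin> A\<close> show False by (auto simp: maximal_def)
  qed
  moreover have "span A \<subseteq> W"
    using W AW by (intro span_is_subset) (auto simp: VectorSpace.subspace_def)
  ultimately have span: "W = span A" by blast
  obtain B where B: "finite B" "maximal B (\<lambda>S. A \<subseteq> S \<and> S \<subseteq> carrier_vec n \<and> lin_indpt S)"
    using maximal_exists[of "\<lambda>S. A \<subseteq> S \<and> S \<subseteq> carrier_vec n \<and> lin_indpt S" dim A] bounded AV li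
    by blast
  then have "A \<subseteq> B" by (auto simp: maximal_def)
  \<comment> \<open>Every set larger than \<open>B\<close> still contains \<open>A\<close>, so
    maximality among the supersets of \<open>A\<close> is maximality among all independent
    sets.\<close>
  have "maximal B (\<lambda>S. S \<subseteq> carrier_vec n \<and> lin_indpt S)"
    using B(2) unfolding maximal_def by (meson order_trans)
  then have basis: "basis B" by (rule max_li_is_basis)
  obtain xs where xs: "set xs = A" "distinct xs"
    using finite_distinct_list[OF A(1)] by blast
  obtain ys where ys: "set ys = B - A" "distinct ys"
    using finite_distinct_list[of "B - A"] B(1) by blast
  show thesis
    by (rule that[of xs ys]) (use xs ys span AW basis \<open>A \<subseteq> B\<close> in \<open>auto simp: Un_absorb1\<close>)
qed

text \<open>The columns of \<open>P\<close> form a basis of the whole space that starts with a basis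
  of \<open>W\<close>; \<open>r\<close> is the dimension of \<open>W\<close>, and
  \<open>Q *\<^sub>v w\<close> is the coordinate vector of \<open>w\<close>. Conjugation by
  \<open>P\<close> makes every matrix that preserves \<open>W\<close> block upper
  triangular.\<close>

lemma (in vec_space) subspace_adapted_matrix:
  assumes W: "VectorSpace.subspace class_ring W V" and nz: "W \<noteq> {0\<^sub>v n}" and nV: "W \<noteq> carrier_vec n"
  obtains P Q :: "'a mat" and r where "P \<in> carrier_mat n n" "Q \<in> carrier_mat n n"
    "P * Q = 1\<^sub>m n" "Q * P = 1\<^sub>m n" "0 < r" "r < n"
    "\<And>j. j < r \<Longrightarrow> col P j \<in> W"
    "\<And>w i. w \<in> W \<Longrightarrow> r \<le> i \<Longrightarrow> i < n \<Longrightarrow> (Q *\<^sub>v w) $ i = 0"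
proof -
  obtain xs ys where d: "distinct (xs @ ys)" and xsW: "set xs \<subseteq> W" and Wspan: "W = span (set xs)"
    and basis: "basis (set (xs @ ys))"
    using extend_subspace_basis[OF W] by blast
  let ?bs = "xs @ ys"
  have bsV: "set ?bs \<subseteq> carrier_vec n" using basis by (auto simp: basis_def)
  then have xsV: "set xs \<subseteq> carrier_vec n" by auto
  have len: "length ?bs = n"
    using dim_basis[OF _ basis] dim_is_n distinct_card[OF d] by auto
  define P where "P = mat_of_cols n ?bs"
  have P: "P \<in> carrier_mat n n" using len by (auto simp: P_def)
  \<comment> \<open>Linear combinations of the basis are products of \<open>P\<close> with
    coefficient vectors, so surjectivity of \<open>P\<close> is the spanning property.\<close>
  have comb: "lincomb f (set ?bs) = P *\<^sub>v vec n (\<lambda>i. f (?bs ! i))" for f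
  proof -
    have "lincomb f (set ?bs) = lincomb_list (\<lambda>i. f (?bs ! i)) ?bs"
      by (rule lincomb_as_lincomb_list_distinct[OF bsV d])
    also have "\<dots> = mat_of_cols n ?bs *\<^sub>v vec (length ?bs) (\<lambda>i. f (?bs ! i))"
      by (rule lincomb_list_as_mat_mult) (use bsV in auto)
    finally show ?thesis unfolding P_def len .
  qed
  have "\<exists>c\<in>carrier_vec n. P *\<^sub>v c = v" if "v \<in> carrier_vec n" for v
  proof -
    have "v \<in> span (set ?bs)" using that basis by (auto simp: basis_def)
    then obtain f where "v = lincomb f (set ?bs)"
      using finite_span[of "set ?bs"] bsV by auto
    with comb[of f] show ?thesis by (intro bexI[of _ "vec n (\<lambda>i. f (?bs ! i))"]) auto
  qed
  from surj_mat_imp_inverse[OF P this] obtain Q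
    where Q: "Q \<in> carrier_mat n n" "P * Q = 1\<^sub>m n" "Q * P = 1\<^sub>m n" by blast
  \<comment> \<open>\<open>W\<close> is nonzero, so \<open>xs\<close> is nonempty; \<open>W\<close>
    is not the whole space, so \<open>ys\<close> is nonempty. This gives the strict bounds on
    \<open>r\<close>.\<close>
  have "xs \<noteq> []"
  proof
    assume "xs = []"
    with Wspan nz show False by (simp add: span_empty)
  qed
  moreover have "ys \<noteq> []"
  proof
    assume "ys = []"
    with Wspan nV basis show False by (simp add: basis_def)
  qed
  ultimately have r: "0 < length xs" "length xs < n" using len by (cases ys, auto)
  have colP: "col P j \<in> W" if "j < length xs" for j
  proof -
    have "col P j = xs ! j"
      using that bsV len unfolding P_def by (subst col_mat_of_cols) (auto simp: nth_append)
    with that xsW show ?thesis by auto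
  qed
  have zero: "(Q *\<^sub>v w) $ i = 0" if w: "w \<in> W" and i: "length xs \<le> i" "i < n" for w i
  proof -
    obtain f where f: "w = lincomb f (set xs)"
      using w finite_span[of "set xs"] xsV unfolding Wspan by auto
    \<comment> \<open>Coefficients of \<open>w\<close> on \<open>xs\<close>, extended by zero to
      \<open>ys\<close>; the coordinate vector \<open>?c\<close> therefore vanishes from position
      \<open>length xs\<close> on.\<close>
    let ?g = "\<lambda>v. if v \<in> set xs then f v else 0"
    let ?c = "vec n (\<lambda>i. ?g (?bs ! i))"
    have "w = P *\<^sub>v ?c"
    proof -
      have "lincomb ?g (set ?bs) = lincomb ?g (set xs \<union> set ys)" by simp
      also have "\<dots> = lincomb ?g (set xs) + lincomb ?g (set ys)"
        using d bsV by (intro lincomb_union) auto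
      also have "lincomb ?g (set ys) = 0\<^sub>v n"
      proof -
        have "lincomb ?g (set ys) = lincomb (\<lambda>_. 0) (set ys)"
          using d bsV by (intro lincomb_cong) auto
        then show ?thesis using bsV by (simp add: lincomb_zero)
      qed
      also have "lincomb ?g (set xs) = w"
        unfolding f using xsV by (intro lincomb_cong) auto
      finally show ?thesis
        using comb[of ?g] f lincomb_closed[OF xsV, of f] by simp
    qed
    then have "Q *\<^sub>v w = (Q * P) *\<^sub>v ?c" using P Q(1) by simp
    also have "\<dots> = ?c" using Q(3) by simp
    finally have "Q *\<^sub>v w = ?c" .
    moreover have "?bs ! i \<notin> set xs"
      using i len d by (auto simp: nth_append)
    ultimately show ?thesis using i by simp
  qed
  show thesis
    by (rule that[OF P Q r colP zero])
qed

section \<open>Representations and irreducible constituents\<close>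

text \<open>Invertibility is automatic in the backward direction, since the matrix of the inverse
  element is a two-sided inverse. All later proofs use this matrix form in place of homomorphisms
  into the unit group.\<close>

lemma representation_iff:
  assumes "group G"
  shows "representation G n \<rho> \<longleftrightarrow>
    (\<forall>g\<in>carrier G. \<rho> g \<in> carrier_mat n n) \<and>
    (\<forall>g\<in>carrier G. \<forall>h\<in>carrier G. \<rho> (g \<otimes>\<^bsub>G\<^esub> h) = \<rho> g * \<rho> h) \<and>
    \<rho> \<one>\<^bsub>G\<^esub> = 1\<^sub>m n" (is "?L \<longleftrightarrow> ?R")
proof -
  interpret G: group G by fact
  interpret R: ring "ring_mat TYPE(complex) n ()" by (rule ring_mat)
  let ?U = "units_of (ring_mat TYPE(complex) n ())"
  have simps: "carrier ?U = Units (ring_mat TYPE(complex) n ())" "(\<otimes>\<^bsub>?U\<^esub>) = (*)" "\<one>\<^bsub>?U\<^esub> = 1\<^sub>m n"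
    by (simp_all add: units_of_def ring_mat_def)
  show ?thesis
  proof
    assume ?L
    then have hom: "\<rho> \<in> hom G ?U" by (simp add: representation_def)
    have "group_hom G ?U \<rho>"
      using hom R.units_group by (simp add: group_hom_def group_hom_axioms_def G.is_group)
    then have "\<rho> \<one>\<^bsub>G\<^esub> = 1\<^sub>m n" using group_hom.hom_one simps by metis
    with hom show ?R
      by (auto simp: hom_def simps Units_def ring_mat_simps Pi_iff)
  next
    assume R: ?R
    have "\<rho> g \<in> Units (ring_mat TYPE(complex) n ())" if g: "g \<in> carrier G" for g
    proof -
      have "\<rho> g * \<rho> (inv\<^bsub>G\<^esub> g) = 1\<^sub>m n" "\<rho> (inv\<^bsub>G\<^esub> g) * \<rho> g = 1\<^sub>m n"
        using R g G.r_inv[OF g] G.l_inv[OF g] G.inv_closed[OF g] by metis+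
      then show ?thesis
        using R g G.inv_closed[OF g] by (auto simp: Units_def ring_mat_simps)
    qed
    then show ?L using R by (simp add: representation_def hom_def simps)
  qed
qed

lemma representation_pow:
  assumes "group G" "representation G n \<rho>" "g \<in> carrier G"
  shows "\<rho> (g [^]\<^bsub>G\<^esub> (k::nat)) = \<rho> g ^\<^sub>m k"
proof -
  interpret group G by fact
  show ?thesis
    using assms by (induction k) (auto simp: representation_iff)
qed

section \<open>Change of basis and diagonal blocks of a representation\<close>

lemma representation_conjugate:
  assumes G: "group G" and \<rho>: "representation G n \<rho>"
    and P: "P \<in> carrier_mat n n" and Q: "Q \<in> carrier_mat n n" and PQ: "P * Q = 1\<^sub>m n" "Q * P = 1\<^sub>m n"
  shows "representation G n (\<lambda>g. Q * \<rho> g * P)"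
  unfolding representation_iff[OF G]
proof (intro conjI ballI)
  note R = \<rho>[unfolded representation_iff[OF G]]
  show "Q * \<rho> g * P \<in> carrier_mat n n" if "g \<in> carrier G" for g
    using R that P Q by auto
  show "Q * \<rho> \<one>\<^bsub>G\<^esub> * P = 1\<^sub>m n" using R Q PQ by simp
  fix g h assume gh: "g \<in> carrier G" "h \<in> carrier G"
  then have c: "\<rho> g \<in> carrier_mat n n" "\<rho> h \<in> carrier_mat n n" using R by auto
  have "(Q * \<rho> g * P) * (Q * \<rho> h * P) = Q * \<rho> g * ((P * Q) * (\<rho> h * P))"
    using P Q c by (simp add: assoc_mult_mat[of _ n n _ n _ n] mult_carrier_mat[of _ n n])
  also have "\<dots> = Q * (\<rho> g * \<rho> h) * P"
    using P Q c PQ by (simp add: assoc_mult_mat[of _ n n _ n _ n] mult_carrier_mat[of _ n n])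
  finally show "Q * \<rho> (g \<otimes>\<^bsub>G\<^esub> h) * P = (Q * \<rho> g * P) * (Q * \<rho> h * P)"
    using R gh by simp
qed

text \<open>This is the subrepresentation on the first \<open>r\<close> coordinates. In the product
  of two matrices, the terms with inner index \<open>k\<close> at least \<open>r\<close> drop out
  because the second factor has a vanishing lower left block.\<close>

lemma representation_upper_left:
  assumes G: "group G" and \<rho>: "representation G n \<rho>" and r: "r \<le> n"
    and zero: "\<And>g i j. \<lbrakk>g \<in> carrier G; r \<le> i; i < n; j < r\<rbrakk> \<Longrightarrow> \<rho> g $$ (i, j) = 0"
  shows "representation G r (\<lambda>g. mat r r (\<lambda>(i, j). \<rho> g $$ (i, j)))"
  unfolding representation_iff[OF G]
proof (intro conjI ballI)
  note R = \<rho>[unfolded representation_iff[OF G]]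
  show "mat r r (\<lambda>(i, j). \<rho> \<one>\<^bsub>G\<^esub> $$ (i, j)) = 1\<^sub>m r"
    using R r by (intro eq_matI) auto
  fix g h assume gh: "g \<in> carrier G" "h \<in> carrier G"
  then have c: "\<rho> g \<in> carrier_mat n n" "\<rho> h \<in> carrier_mat n n" using R by auto
  show "mat r r (\<lambda>(i, j). \<rho> (g \<otimes>\<^bsub>G\<^esub> h) $$ (i, j)) =
    mat r r (\<lambda>(i, j). \<rho> g $$ (i, j)) * mat r r (\<lambda>(i, j). \<rho> h $$ (i, j))" (is "?l = ?x * ?y")
  proof (rule eq_matI)
    fix i j assume "i < dim_row (?x * ?y)" "j < dim_col (?x * ?y)"
    then have ij: "i < r" "j < r" by auto
    have "?l $$ (i, j) = (\<Sum>k<n. \<rho> g $$ (i, k) * \<rho> h $$ (k, j))"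
      using ij r R gh carrier_matD[OF c(1)] carrier_matD[OF c(2)]
      by (simp add: scalar_prod_def atLeast0LessThan)
    also have "\<dots> = (\<Sum>k<r. \<rho> g $$ (i, k) * \<rho> h $$ (k, j))"
      using r ij zero gh by (intro sum.mono_neutral_right) auto
    also have "\<dots> = (?x * ?y) $$ (i, j)"
      using ij by (simp add: scalar_prod_def atLeast0LessThan)
    finally show "?l $$ (i, j) = (?x * ?y) $$ (i, j)" .
  qed auto
qed auto

text \<open>This is the quotient representation by the first \<open>r\<close> coordinates. Here the
  terms with \<open>k < r\<close> drop out, by the vanishing lower left block of the first
  factor.\<close>

lemma representation_lower_right:
  assumes G: "group G" and \<rho>: "representation G (r + s) \<rho>"
    and zero: "\<And>g i j. \<lbrakk>g \<in> carrier G; r \<le> i; i < r + s; j < r\<rbrakk> \<Longrightarrow> \<rho> g $$ (i, j) = 0"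
  shows "representation G s (\<lambda>g. mat s s (\<lambda>(i, j). \<rho> g $$ (r + i, r + j)))"
  unfolding representation_iff[OF G]
proof (intro conjI ballI)
  note R = \<rho>[unfolded representation_iff[OF G]]
  show "mat s s (\<lambda>(i, j). \<rho> \<one>\<^bsub>G\<^esub> $$ (r + i, r + j)) = 1\<^sub>m s"
    using R by (intro eq_matI) auto
  fix g h assume gh: "g \<in> carrier G" "h \<in> carrier G"
  then have c: "\<rho> g \<in> carrier_mat (r + s) (r + s)" "\<rho> h \<in> carrier_mat (r + s) (r + s)"
    using R by auto
  show "mat s s (\<lambda>(i, j). \<rho> (g \<otimes>\<^bsub>G\<^esub> h) $$ (r + i, r + j)) =
    mat s s (\<lambda>(i, j). \<rho> g $$ (r + i, r + j)) * mat s s (\<lambda>(i, j). \<rho> h $$ (r + i, r + j))"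
    (is "?l = ?x * ?y")
  proof (rule eq_matI)
    fix i j assume "i < dim_row (?x * ?y)" "j < dim_col (?x * ?y)"
    then have ij: "i < s" "j < s" by auto
    let ?f = "\<lambda>k. \<rho> g $$ (r + i, k) * \<rho> h $$ (k, r + j)"
    have "?l $$ (i, j) = (\<Sum>k<r + s. ?f k)"
      using ij R gh carrier_matD[OF c(1)] carrier_matD[OF c(2)]
      by (simp add: scalar_prod_def atLeast0LessThan)
    also have "\<dots> = (\<Sum>k\<in>(\<lambda>k. r + k) ` {..<s}. ?f k)"
    proof (rule sum.mono_neutral_right)
      show "\<forall>k\<in>{..<r + s} - (\<lambda>k. r + k) ` {..<s}. ?f k = 0"
      proof
        fix k assume k: "k \<in> {..<r + s} - (\<lambda>k. r + k) ` {..<s}"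
        have "k < r"
        proof (rule ccontr)
          assume "\<not> k < r"
          then have "k = r + (k - r)" "k - r < s" using k by auto
          with k show False by blast
        qed
        with zero[of g "r + i" k] gh ij show "?f k = 0" by simp
      qed
    qed auto
    also have "\<dots> = (\<Sum>k<s. ?f (r + k))"
      by (subst sum.reindex) auto
    also have "\<dots> = (?x * ?y) $$ (i, j)"
      using ij by (simp add: scalar_prod_def atLeast0LessThan)
    finally show "?l $$ (i, j) = (?x * ?y) $$ (i, j)" .
  qed auto
qed auto

text \<open>The upper right blocks add up under multiplication of such matrices.\<close>

lemma unipotent_block_pow:
  fixes U :: "'a :: comm_ring_1 mat"
  assumes "U \<in> carrier_mat n m"
  shows "four_block_mat (1\<^sub>m n) U (0\<^sub>m m n) (1\<^sub>m m) ^\<^sub>m k =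
    four_block_mat (1\<^sub>m n) (of_nat k \<cdot>\<^sub>m U) (0\<^sub>m m n) (1\<^sub>m m)"
proof (induction k)
  case 0
  have "0 \<cdot>\<^sub>m U = 0\<^sub>m n m" using assms by (intro eq_matI) auto
  then show ?case by simp
next
  case (Suc k)
  have "four_block_mat (1\<^sub>m n) U (0\<^sub>m m n) (1\<^sub>m m) ^\<^sub>m Suc k =
    four_block_mat (1\<^sub>m n) (of_nat k \<cdot>\<^sub>m U) (0\<^sub>m m n) (1\<^sub>m m) *
    four_block_mat (1\<^sub>m n) U (0\<^sub>m m n) (1\<^sub>m m)"
    by (simp add: Suc)
  also have "\<dots> = four_block_mat (1\<^sub>m n * 1\<^sub>m n + (of_nat k \<cdot>\<^sub>m U) * 0\<^sub>m m n)
      (1\<^sub>m n * U + (of_nat k \<cdot>\<^sub>m U) * 1\<^sub>m m) (0\<^sub>m m n * 1\<^sub>m n + 1\<^sub>m m * 0\<^sub>m m n)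
      (0\<^sub>m m n * U + 1\<^sub>m m * 1\<^sub>m m)"
    by (rule mult_four_block_mat[of _ n n _ m _ m]) (use assms in auto)
  also have "1\<^sub>m n * 1\<^sub>m n + (of_nat k \<cdot>\<^sub>m U) * 0\<^sub>m m n = 1\<^sub>m n"
    using assms by (intro eq_matI) auto
  also have "0\<^sub>m m n * 1\<^sub>m n + 1\<^sub>m m * 0\<^sub>m m n = (0\<^sub>m m n :: 'a mat)"
    by (intro eq_matI) auto
  also have "0\<^sub>m m n * U + 1\<^sub>m m * 1\<^sub>m m = (1\<^sub>m m :: 'a mat)"
    using assms by (intro eq_matI) auto
  also have "1\<^sub>m n * U + (of_nat k \<cdot>\<^sub>m U) * 1\<^sub>m m = of_nat (Suc k) \<cdot>\<^sub>m U"
  proof -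
    have "1\<^sub>m n * U = U" "(of_nat k \<cdot>\<^sub>m U) * 1\<^sub>m m = of_nat k \<cdot>\<^sub>m U"
      using assms by auto
    moreover have "U + of_nat k \<cdot>\<^sub>m U = of_nat (Suc k) \<cdot>\<^sub>m U"
      using assms by (intro eq_matI) (auto simp: algebra_simps)
    ultimately show ?thesis by simp
  qed
  finally show ?case .
qed

text \<open>By the power formula, finite order means that \<open>m\<close> times the upper right
  block \<open>U\<close> is zero, so \<open>U\<close> is zero in characteristic 0.\<close>

lemma finite_order_block_unipotent:
  fixes A :: "'a :: field_char_0 mat"
  assumes A: "A \<in> carrier_mat (r + s) (r + s)" and pow: "A ^\<^sub>m m = 1\<^sub>m (r + s)" "0 < m"
    and ul: "mat r r (\<lambda>(i, j). A $$ (i, j)) = 1\<^sub>m r"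
    and lr: "mat s s (\<lambda>(i, j). A $$ (r + i, r + j)) = 1\<^sub>m s"
    and zero: "\<And>i j. \<lbrakk>r \<le> i; i < r + s; j < r\<rbrakk> \<Longrightarrow> A $$ (i, j) = 0"
  shows "A = 1\<^sub>m (r + s)"
proof -
  define U where "U = mat r s (\<lambda>(i, j). A $$ (i, r + j))"
  have U: "U \<in> carrier_mat r s" by (simp add: U_def)
  have block: "A = four_block_mat (1\<^sub>m r) U (0\<^sub>m s r) (1\<^sub>m s)"
    unfolding ul[symmetric] lr[symmetric]
    by (rule eq_matI) (use A zero in \<open>auto simp: U_def\<close>)
  have "of_nat m \<cdot>\<^sub>m U = 0\<^sub>m r s"
    using pow(1) U four_block_mat_one_iff[of "1\<^sub>m r" r "of_nat m \<cdot>\<^sub>m U" s "0\<^sub>m s r" "1\<^sub>m s"]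
    unfolding block unipotent_block_pow[OF U] by simp
  have "U = 0\<^sub>m r s"
  proof (rule eq_matI)
    fix i j assume "i < dim_row (0\<^sub>m r s :: 'a mat)" "j < dim_col (0\<^sub>m r s :: 'a mat)"
    then show "U $$ (i, j) = 0\<^sub>m r s $$ (i, j)"
      using arg_cong[OF \<open>of_nat m \<cdot>\<^sub>m U = 0\<^sub>m r s\<close>, of "\<lambda>M. M $$ (i, j)"] U pow(2) by simp
  qed (use U in auto)
  then show ?thesis unfolding block by simp
qed

text \<open>Induction on the degree. An invariant subspace makes the matrices block upper
  triangular; if \<open>h\<close> acted trivially on both diagonal blocks, its matrix would be
  unipotent of finite order, hence the identity. Carrying the kernel condition along keeps a normal
  subgroup on which \<open>\<rho>\<close> is trivial in the kernel of the constituent.\<close>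

lemma irreducible_constituent_nontrivial:
  assumes G: "group G" and h: "h \<in> carrier G" "h [^]\<^bsub>G\<^esub> (m::nat) = \<one>\<^bsub>G\<^esub>" "0 < m"
    and "representation G n \<rho>" and "\<rho> h \<noteq> 1\<^sub>m n"
  shows "\<exists>k \<sigma>. irreducible_representation G k \<sigma> \<and>
    (\<forall>x\<in>carrier G. \<rho> x = 1\<^sub>m n \<longrightarrow> \<sigma> x = 1\<^sub>m k) \<and> \<sigma> h \<noteq> 1\<^sub>m k"
  using assms(5,6)
proof (induction n arbitrary: \<rho> rule: less_induct)
  case (less n)
  note \<rho> = less.prems(1)
  note R = \<rho>[unfolded representation_iff[OF G]]
  show ?case
  proof (cases "irreducible_representation G n \<rho>")
    case True
    with less.prems show ?thesis by blast
  next
    case False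
    \<comment> \<open>Degree 0 must be ruled out before the failure of irreducibility yields an
      invariant subspace; there every matrix is the identity, against the choice of
      \<open>h\<close>.\<close>
    have "n \<noteq> 0"
    proof
      assume "n = 0"
      then have "\<rho> h = 1\<^sub>m n" using R h by (intro eq_matI) auto
      with less.prems show False by simp
    qed
    with False \<rho> obtain W where
      W: "VectorSpace.subspace class_ring W (module_vec TYPE(complex) n)"
        "\<And>g w. g \<in> carrier G \<Longrightarrow> w \<in> W \<Longrightarrow> \<rho> g *\<^sub>v w \<in> W"
        "W \<noteq> {0\<^sub>v n}" "W \<noteq> carrier_vec n"
      unfolding irreducible_representation_def by blast
    interpret vec_space "TYPE(complex)" n .
    obtain P Q r where PQ: "P \<in> carrier_mat n n" "Q \<in> carrier_mat n n"
      "P * Q = 1\<^sub>m n" "Q * P = 1\<^sub>m n" and r: "0 < r" "r < n"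
      and colP: "\<And>j. j < r \<Longrightarrow> col P j \<in> W"
      and zeroQ: "\<And>w i. w \<in> W \<Longrightarrow> r \<le> i \<Longrightarrow> i < n \<Longrightarrow> (Q *\<^sub>v w) $ i = 0"
      using subspace_adapted_matrix[OF W(1,3,4)] by blast
    define \<tau> where "\<tau> g = Q * \<rho> g * P" for g
    have \<tau>: "representation G n \<tau>"
      unfolding \<tau>_def by (rule representation_conjugate[OF G \<rho> PQ])
    have \<tau>_one_iff: "\<tau> x = 1\<^sub>m n \<longleftrightarrow> \<rho> x = 1\<^sub>m n" if "x \<in> carrier G" for x
    proof
      have c: "\<rho> x \<in> carrier_mat n n" using R that by blast
      assume "\<tau> x = 1\<^sub>m n"
      then have "P * (Q * \<rho> x * P) * Q = 1\<^sub>m n" using PQ by (simp add: \<tau>_def)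
      moreover have "P * (Q * \<rho> x * P) * Q = (P * Q) * \<rho> x * (P * Q)"
        using PQ(1,2) c by (simp add: assoc_mult_mat[of _ n n _ n _ n] mult_carrier_mat[of _ n n])
      ultimately show "\<rho> x = 1\<^sub>m n" using PQ c by simp
    qed (use PQ in \<open>simp add: \<tau>_def\<close>)
    \<comment> \<open>Column \<open>j\<close> of \<open>\<tau> g\<close> holds the coordinates of
      the image under \<open>\<rho> g\<close> of a vector of \<open>W\<close>, which lies in
      \<open>W\<close> by invariance.\<close>
    have zero: "\<tau> g $$ (i, j) = 0" if g: "g \<in> carrier G" and ij: "r \<le> i" "i < n" "j < r" for g i j
    proof -
      have c: "\<rho> g \<in> carrier_mat n n" using R g by blast
      have j: "j < n" using ij r by simp
      have "\<tau> g $$ (i, j) = col (\<tau> g) j $ i"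
        using ij j PQ c by (simp add: \<tau>_def)
      also have "col (\<tau> g) j = Q *\<^sub>v (\<rho> g *\<^sub>v col P j)"
      proof -
        have "\<tau> g = Q * (\<rho> g * P)"
          using PQ(1,2) c by (simp add: \<tau>_def)
        then have "col (\<tau> g) j = Q *\<^sub>v col (\<rho> g * P) j"
          using col_mult2[of Q n n "\<rho> g * P" n j] PQ(1,2) c j by auto
        then show ?thesis using col_mult2[OF c PQ(1) j] by simp
      qed
      also have "\<dots> $ i = 0" using W(2) colP zeroQ g ij by simp
      finally show ?thesis .
    qed
    \<comment> \<open>Since \<open>0 < r\<close>, the quotient degree \<open>s\<close> is below
      \<open>n\<close> as well, so the induction hypothesis covers both blocks.\<close>
    obtain s where s: "n = r + s" "s < n" using r less_imp_add_positive[of r n] by auto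
    define \<alpha> where "\<alpha> g = mat r r (\<lambda>(i, j). \<tau> g $$ (i, j))" for g
    define \<delta> where "\<delta> g = mat s s (\<lambda>(i, j). \<tau> g $$ (r + i, r + j))" for g
    have \<alpha>: "representation G r \<alpha>"
      unfolding \<alpha>_def using representation_upper_left[OF G \<tau> _ zero] r by simp
    have \<delta>: "representation G s \<delta>"
      unfolding \<delta>_def using representation_lower_right[OF G, of r s \<tau>] \<tau> zero unfolding s(1) by blast
    have ker: "\<alpha> x = 1\<^sub>m r \<and> \<delta> x = 1\<^sub>m s" if "x \<in> carrier G" "\<rho> x = 1\<^sub>m n" for x
      using \<tau>_one_iff[OF that(1)] that(2) s(1) by (auto simp: \<alpha>_def \<delta>_def)
    have "\<alpha> h \<noteq> 1\<^sub>m r \<or> \<delta> h \<noteq> 1\<^sub>m s"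
    proof (rule ccontr)
      assume "\<not> ?thesis"
      moreover have "\<tau> h ^\<^sub>m m = 1\<^sub>m n"
        using representation_pow[OF G \<tau> h(1), of m] h(2) \<tau>[unfolded representation_iff[OF G]] by simp
      moreover have "\<tau> h \<in> carrier_mat n n"
        using \<tau>[unfolded representation_iff[OF G]] h(1) by blast
      ultimately have "\<tau> h = 1\<^sub>m n"
        using finite_order_block_unipotent[of "\<tau> h" r s m] zero[OF h(1)] h(3)
        unfolding \<alpha>_def \<delta>_def s(1) by blast
      with \<tau>_one_iff[OF h(1)] less.prems show False by simp
    qed
    then show ?thesis
      using less.IH[OF r(2) \<alpha>] less.IH[OF s(2) \<delta>] ker by meson
  qed
qed

section \<open>The regular representation and separation of elements from normal subgroups\<close>

lemma regular_representation:
  assumes G: "group G" and fin: "finite (carrier G)"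
  obtains n \<rho> where "representation G n \<rho>"
    "\<And>g. g \<in> carrier G \<Longrightarrow> \<rho> g = 1\<^sub>m n \<Longrightarrow> g = \<one>\<^bsub>G\<^esub>"
proof -
  interpret group G by fact
  define n where "n = card (carrier G)"
  obtain f where f: "bij_betw f {..<n} (carrier G)"
    using ex_bij_betw_nat_finite[OF fin] by (auto simp: n_def atLeast0LessThan)
  then have inj: "f i = f j \<longleftrightarrow> i = j" if "i < n" "j < n" for i j
    using that by (auto simp: bij_betw_def inj_on_def)
  have fc: "f i \<in> carrier G" if "i < n" for i
    using f that by (auto simp: bij_betw_def)
  \<comment> \<open>Permutation matrix of left multiplication by \<open>g\<close>, in the
    enumeration \<open>f\<close> of the group.\<close>
  define \<rho> where "\<rho> g = mat n n (\<lambda>(i, j). if f i = g \<otimes>\<^bsub>G\<^esub> f j then 1 else 0 :: complex)" for g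
  have "representation G n \<rho>"
    unfolding representation_iff[OF G]
  proof (intro conjI ballI)
    show "\<rho> \<one>\<^bsub>G\<^esub> = 1\<^sub>m n"
      by (rule eq_matI) (auto simp: \<rho>_def fc inj)
    fix g h assume gh: "g \<in> carrier G" "h \<in> carrier G"
    show "\<rho> (g \<otimes>\<^bsub>G\<^esub> h) = \<rho> g * \<rho> h"
    proof (rule eq_matI)
      fix i j assume "i < dim_row (\<rho> g * \<rho> h)" "j < dim_col (\<rho> g * \<rho> h)"
      then have ij: "i < n" "j < n" by (auto simp: \<rho>_def)
      \<comment> \<open>The only inner index that contributes to the matrix product at column
        \<open>j\<close>.\<close>
      obtain l where l: "l < n" "f l = h \<otimes>\<^bsub>G\<^esub> f j"
        using f gh fc[OF ij(2)] by (metis (no_types, lifting) bij_betw_iff_bijections lessThan_iff m_closed)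
      have "(\<rho> g * \<rho> h) $$ (i, j) = (\<Sum>k<n. \<rho> g $$ (i, k) * \<rho> h $$ (k, j))"
        using ij by (simp add: \<rho>_def scalar_prod_def atLeast0LessThan)
      also have "\<dots> = (\<Sum>k\<in>{l}. \<rho> g $$ (i, k) * \<rho> h $$ (k, j))"
        by (rule sum.mono_neutral_right) (use l ij inj[of _ l] in \<open>auto simp: \<rho>_def simp flip: l(2)\<close>)
      also have "\<dots> = \<rho> (g \<otimes>\<^bsub>G\<^esub> h) $$ (i, j)"
        using l ij gh fc by (simp add: \<rho>_def m_assoc)
      finally show "\<rho> (g \<otimes>\<^bsub>G\<^esub> h) $$ (i, j) = (\<rho> g * \<rho> h) $$ (i, j)" by simp
    qed (auto simp: \<rho>_def)
  qed (auto simp: \<rho>_def)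
  moreover have "g = \<one>\<^bsub>G\<^esub>" if g: "g \<in> carrier G" "\<rho> g = 1\<^sub>m n" for g
  proof -
    \<comment> \<open>One diagonal entry suffices for faithfulness: it shows that \<open>g\<close>
      fixes \<open>f 0\<close> under left multiplication.\<close>
    have "0 < n" using fin by (auto simp: n_def card_gt_0_iff)
    then have "\<rho> g $$ (0, 0) = 1" using g(2) by simp
    then have "f 0 = g \<otimes>\<^bsub>G\<^esub> f 0"
      using \<open>0 < n\<close> by (simp add: \<rho>_def split: if_splits)
    then show ?thesis using fc[OF \<open>0 < n\<close>] g(1) by (metis r_cancel_one)
  qed
  ultimately show thesis by (rule that)
qed

text \<open>The regular representation of \<open>G Mod N\<close>, pulled back to \<open>G\<close>,
  has kernel exactly \<open>N\<close>. Some irreducible constituent still moves \<open>h\<close>,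
  and all of them are trivial on \<open>N\<close>.\<close>

lemma irreducible_representation_separates:
  assumes G: "group G" and fin: "finite (carrier G)" and N: "N \<lhd> G"
    and h: "h \<in> carrier G" "h \<notin> N"
  shows "\<exists>n \<sigma>. irreducible_representation G n \<sigma> \<and> (\<forall>x\<in>N. \<sigma> x = 1\<^sub>m n) \<and> \<sigma> h \<noteq> 1\<^sub>m n"
proof -
  interpret group G by fact
  interpret N: normal N G by fact
  have Q: "group (G Mod N)" by (rule N.factorgroup_is_group)
  have "finite (carrier (G Mod N))"
    using fin by (auto simp: FactGroup_def RCOSETS_def)
  then obtain n \<rho> where \<rho>: "representation (G Mod N) n \<rho>"
    and faithful: "\<And>C. C \<in> carrier (G Mod N) \<Longrightarrow> \<rho> C = 1\<^sub>m n \<Longrightarrow> C = \<one>\<^bsub>G Mod N\<^esub>"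
    using regular_representation[OF Q] by blast
  let ?\<rho> = "\<rho> \<circ> (\<lambda>x. N #>\<^bsub>G\<^esub> x)"
  have rep: "representation G n ?\<rho>"
    using \<rho> Group.hom_compose[OF N.r_coset_hom_Mod] by (simp add: representation_def)
  have trivial: "?\<rho> x = 1\<^sub>m n" if "x \<in> N" for x
  proof -
    have "N #>\<^bsub>G\<^esub> x = \<one>\<^bsub>G Mod N\<^esub>"
      using N.rcos_const[OF is_group that] by (simp add: FactGroup_def)
    then show ?thesis using \<rho> unfolding representation_iff[OF Q] by simp
  qed
  have "?\<rho> h \<noteq> 1\<^sub>m n"
  proof
    assume "?\<rho> h = 1\<^sub>m n"
    moreover have "N #>\<^bsub>G\<^esub> h \<in> carrier (G Mod N)"
      using h(1) by (auto simp: FactGroup_def RCOSETS_def)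
    ultimately have "N #>\<^bsub>G\<^esub> h = N"
      using faithful by (simp add: FactGroup_def)
    with h show False using coset_join1[OF _ h(1) N.is_subgroup] by blast
  qed
  moreover have "h [^]\<^bsub>G\<^esub> Coset.order G = \<one>\<^bsub>G\<^esub>" "0 < Coset.order G"
    using h(1) fin by (simp_all add: pow_order_eq_1 order_gt_0_iff_finite)
  ultimately obtain k \<sigma> where "irreducible_representation G k \<sigma>"
    "\<forall>x\<in>carrier G. ?\<rho> x = 1\<^sub>m n \<longrightarrow> \<sigma> x = 1\<^sub>m k" "\<sigma> h \<noteq> 1\<^sub>m k"
    using irreducible_constituent_nontrivial[OF G h(1) _ _ rep] by blast
  with trivial N.subset show ?thesis by blast
qed

section \<open>Characters, kernels and normal closures\<close>

lemma character_one:
  assumes "group G" "representation G n \<rho>"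
  shows "character G \<rho> \<one>\<^bsub>G\<^esub> = of_nat n"
  using assms by (simp add: representation_iff character_def mat_trace_def group.is_monoid)

text \<open>Matrices of group elements have order dividing the group order, so the trace criterion
  for finite order applies. The kernel can thus be read off from the character alone.\<close>

lemma character_eq_degree_iff:
  assumes G: "group G" and fin: "finite (carrier G)" and \<rho>: "representation G n \<rho>"
    and g: "g \<in> carrier G"
  shows "character G \<rho> g = character G \<rho> \<one>\<^bsub>G\<^esub> \<longleftrightarrow> \<rho> g = 1\<^sub>m n"
proof
  interpret group G by fact
  note R = \<rho>[unfolded representation_iff[OF G]]
  assume "character G \<rho> g = character G \<rho> \<one>\<^bsub>G\<^esub>"
  then have tr: "mat_trace (\<rho> g) = of_nat n"
    using g by (simp add: character_one[OF G \<rho>]) (simp add: character_def)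
  have "\<rho> g ^\<^sub>m Coset.order G = 1\<^sub>m n"
    using representation_pow[OF G \<rho> g, of "Coset.order G"] R g by (simp add: pow_order_eq_1)
  moreover have "0 < Coset.order G" using fin by (simp add: order_gt_0_iff_finite)
  ultimately show "\<rho> g = 1\<^sub>m n"
    using finite_order_mat_trace[of "\<rho> g" n] R g tr by blast
next
  interpret group G by fact
  assume "\<rho> g = 1\<^sub>m n"
  with \<rho> g show "character G \<rho> g = character G \<rho> \<one>\<^bsub>G\<^esub>"
    by (simp add: representation_iff[OF G] character_def)
qed

text \<open>The coefficients determine the character up to the factor given by its degree. The value
  at the identity gives the square of the degree, hence the degree, which is nonzero and can be
  cancelled.\<close>

lemma central_idempotent_inj_on_Irr:
  assumes G: "group G" and fin: "finite (carrier G)"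
  shows "inj_on (central_idempotent G) (Irr G)"
proof (rule inj_onI)
  interpret group G by fact
  fix \<chi> \<psi> assume "\<chi> \<in> Irr G" "\<psi> \<in> Irr G" and eq: "central_idempotent G \<chi> = central_idempotent G \<psi>"
  then obtain n m \<rho> \<sigma> where \<rho>: "irreducible_representation G n \<rho>" "\<chi> = character G \<rho>"
    and \<sigma>: "irreducible_representation G m \<sigma>" "\<psi> = character G \<sigma>"
    by (auto simp: Irr_def)
  have one: "\<chi> \<one>\<^bsub>G\<^esub> = of_nat n" "\<psi> \<one>\<^bsub>G\<^esub> = of_nat m" and n: "n \<noteq> 0"
    using \<rho> \<sigma> character_one[OF G] by (auto simp: irreducible_representation_def)
  have ord: "Coset.order G \<noteq> 0" using fin by (metis less_irrefl order_gt_0_iff_finite)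
  \<comment> \<open>Evaluated at the inverse of \<open>x\<close>, because the coefficient at a group
    element involves the character at its inverse.\<close>
  have val: "of_nat n * \<chi> x = of_nat m * \<psi> x" if "x \<in> carrier G" for x
    using fun_cong[OF eq, of "inv\<^bsub>G\<^esub> x"] that one ord by (simp add: central_idempotent_def)
  have "(of_nat (n * n) :: complex) = of_nat (m * m)"
    using val[OF one_closed] one by simp
  then have "n * n = m * m" by (simp only: of_nat_eq_iff)
  then have "n = m" by (metis power2_eq_square power2_eq_imp_eq zero_le)
  show "\<chi> = \<psi>"
  proof
    fix x
    \<comment> \<open>Outside \<open>carrier G\<close> both characters are \<open>undefined\<close>,
      so they agree there too.\<close>
    show "\<chi> x = \<psi> x"
      using val[of x] n \<open>n = m\<close> \<rho>(2) \<sigma>(2) by (cases "x \<in> carrier G") (auto simp: character_def)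
  qed
qed

text \<open>Injectivity allows the idempotents to be replaced by their characters, and the condition
  on a character value then becomes membership in the kernel of the representation.\<close>

lemma E_set_eq_iff:
  assumes G: "group G" and fin: "finite (carrier G)" and gh: "g \<in> carrier G" "h \<in> carrier G"
  shows "E_set G h = E_set G g \<longleftrightarrow>
    (\<forall>n \<rho>. irreducible_representation G n \<rho> \<longrightarrow> (\<rho> h = 1\<^sub>m n \<longleftrightarrow> \<rho> g = 1\<^sub>m n))"
proof -
  have E: "E_set G x = central_idempotent G ` {\<chi> \<in> Irr G. \<chi> x \<noteq> \<chi> \<one>\<^bsub>G\<^esub>}" for x
  proof -
    have nonzero: "1 - \<chi> x / \<chi> \<one>\<^bsub>G\<^esub> \<noteq> 0 \<longleftrightarrow> \<chi> x \<noteq> \<chi> \<one>\<^bsub>G\<^esub>" if "\<chi> \<in> Irr G" for \<chi>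
    proof -
      \<comment> \<open>The degree is nonzero, so the quotient is not the default value 0 of
        division by zero.\<close>
      have "\<chi> \<one>\<^bsub>G\<^esub> \<noteq> 0"
        using that character_one[OF G] by (auto simp: Irr_def irreducible_representation_def)
      then show ?thesis by (simp add: eq_divide_eq_1 eq_commute[of 1])
    qed
    have "E_set G x = central_idempotent G ` {\<chi> \<in> Irr G. 1 - \<chi> x / \<chi> \<one>\<^bsub>G\<^esub> \<noteq> 0}"
      unfolding E_set_def by blast
    also have "{\<chi> \<in> Irr G. 1 - \<chi> x / \<chi> \<one>\<^bsub>G\<^esub> \<noteq> 0} = {\<chi> \<in> Irr G. \<chi> x \<noteq> \<chi> \<one>\<^bsub>G\<^esub>}"
      using nonzero by blast
    finally show ?thesis .
  qed
  have degree: "character G \<rho> x = character G \<rho> \<one>\<^bsub>G\<^esub> \<longleftrightarrow> \<rho> x = 1\<^sub>m n"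
    if "irreducible_representation G n \<rho>" "x \<in> carrier G" for n \<rho> x
    using that character_eq_degree_iff[OF G fin] unfolding irreducible_representation_def by metis
  have "E_set G h = E_set G g \<longleftrightarrow>
      {\<chi> \<in> Irr G. \<chi> h \<noteq> \<chi> \<one>\<^bsub>G\<^esub>} = {\<chi> \<in> Irr G. \<chi> g \<noteq> \<chi> \<one>\<^bsub>G\<^esub>}"
    unfolding E by (rule inj_on_image_eq_iff[OF central_idempotent_inj_on_Irr[OF G fin]]) auto
  also have "\<dots> \<longleftrightarrow> (\<forall>\<chi>\<in>Irr G. \<chi> h = \<chi> \<one>\<^bsub>G\<^esub> \<longleftrightarrow> \<chi> g = \<chi> \<one>\<^bsub>G\<^esub>)"
    by blast
  also have "\<dots> \<longleftrightarrow> (\<forall>n \<rho>. irreducible_representation G n \<rho> \<longrightarrow>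
      (character G \<rho> h = character G \<rho> \<one>\<^bsub>G\<^esub> \<longleftrightarrow> character G \<rho> g = character G \<rho> \<one>\<^bsub>G\<^esub>))"
    unfolding Irr_def by blast
  also have "\<dots> \<longleftrightarrow> (\<forall>n \<rho>. irreducible_representation G n \<rho> \<longrightarrow> (\<rho> h = 1\<^sub>m n \<longleftrightarrow> \<rho> g = 1\<^sub>m n))"
    by (intro iff_allI imp_cong refl) (simp add: degree gh)
  finally show ?thesis .
qed

section \<open>Normal closures of single elements\<close>

definition normal_closure :: "('a, 'b) monoid_scheme \<Rightarrow> 'a \<Rightarrow> 'a set"
  where "normal_closure G g = \<Inter> {N. N \<lhd> G \<and> g \<in> N}"

lemma normal_closure_subset: "N \<lhd> G \<Longrightarrow> g \<in> N \<Longrightarrow> normal_closure G g \<subseteq> N"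
  by (auto simp: normal_closure_def)

lemma mem_normal_closure: "g \<in> normal_closure G g"
  by (auto simp: normal_closure_def)

lemma normal_carrier: "group G \<Longrightarrow> carrier G \<lhd> G"
  by (simp add: group.normal_inv_iff group.subgroup_self group.is_monoid monoid.m_closed group.inv_closed)

lemma normal_closure_normal:
  assumes G: "group G" and g: "g \<in> carrier G"
  shows "normal_closure G g \<lhd> G"
proof -
  interpret group G by fact
  \<comment> \<open>\<open>carrier G\<close> belongs to the intersected family, which is therefore
    nonempty.\<close>
  have "subgroup (normal_closure G g) G"
    unfolding normal_closure_def using normal_carrier[OF G] g
    by (intro subgroups_Inter) (auto simp: normal_inv_iff)
  then show ?thesis
    by (auto simp: normal_inv_iff normal_closure_def)
qed

lemma normal_closure_eq_iff:
  assumes "group G" "g \<in> carrier G" "h \<in> carrier G"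
  shows "normal_closure G h = normal_closure G g \<longleftrightarrow> (\<forall>N. N \<lhd> G \<longrightarrow> (h \<in> N \<longleftrightarrow> g \<in> N))"
proof
  assume "normal_closure G h = normal_closure G g"
  then show "\<forall>N. N \<lhd> G \<longrightarrow> (h \<in> N \<longleftrightarrow> g \<in> N)"
    by (metis mem_normal_closure normal_closure_subset subsetD)
qed (auto simp: normal_closure_def)

text \<open>An element of \<open>N\<close> is removed exactly when its normal closure is a proper
  subgroup of \<open>N\<close>. Hence the nonempty interiors are the fibres of
  \<open>normal_closure G\<close> on the group.\<close>

lemma mem_normal_interior_iff:
  assumes G: "group G" and N: "N \<lhd> G"
  shows "g \<in> normal_interior G N \<longleftrightarrow> g \<in> carrier G \<and> normal_closure G g = N"
proof
  interpret normal N G by fact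
  assume g: "g \<in> normal_interior G N"
  then have gN: "g \<in> N" by (simp add: normal_interior_def)
  then have gc: "g \<in> carrier G" using subset by blast
  have "normal_closure G g \<subseteq> N" by (rule normal_closure_subset[OF N gN])
  moreover have "\<not> normal_closure G g \<subset> N"
    using g normal_closure_normal[OF G gc] mem_normal_closure[of g G]
    unfolding normal_interior_def normal_subgroups_def by blast
  ultimately show "g \<in> carrier G \<and> normal_closure G g = N" using gc by blast
next
  assume "g \<in> carrier G \<and> normal_closure G g = N"
  then show "g \<in> normal_interior G N"
    using mem_normal_closure[of g G] normal_closure_subset[of _ G g]
    by (auto simp: normal_interior_def normal_subgroups_def)
qed

lemma representation_kernel_normal:
  assumes G: "group G" and \<rho>: "representation G n \<rho>"
  shows "{x \<in> carrier G. \<rho> x = 1\<^sub>m n} \<lhd> G"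
proof -
  interpret group G by fact
  note R = \<rho>[unfolded representation_iff[OF G]]
  have inv: "\<rho> x * \<rho> (inv\<^bsub>G\<^esub> x) = 1\<^sub>m n" if "x \<in> carrier G" for x
    using R that by (metis inv_closed r_inv)
  have "subgroup {x \<in> carrier G. \<rho> x = 1\<^sub>m n} G"
  proof (rule subgroupI)
    fix x assume x: "x \<in> {x \<in> carrier G. \<rho> x = 1\<^sub>m n}"
    then have "\<rho> (inv\<^bsub>G\<^esub> x) \<in> carrier_mat n n" using R by simp
    then have "\<rho> (inv\<^bsub>G\<^esub> x) = 1\<^sub>m n" using x inv[of x] by simp
    with x show "inv\<^bsub>G\<^esub> x \<in> {x \<in> carrier G. \<rho> x = 1\<^sub>m n}" by simp
  qed (use R in auto)
  moreover have "\<rho> (x \<otimes>\<^bsub>G\<^esub> y \<otimes>\<^bsub>G\<^esub> inv\<^bsub>G\<^esub> x) = 1\<^sub>m n"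
    if xy: "x \<in> carrier G" "y \<in> carrier G" "\<rho> y = 1\<^sub>m n" for x y
  proof -
    have "\<rho> x \<in> carrier_mat n n" using R xy(1) by blast
    moreover have "\<rho> (x \<otimes>\<^bsub>G\<^esub> y \<otimes>\<^bsub>G\<^esub> inv\<^bsub>G\<^esub> x) = \<rho> x * \<rho> y * \<rho> (inv\<^bsub>G\<^esub> x)"
      using R xy by simp
    ultimately show ?thesis using xy inv by simp
  qed
  ultimately show ?thesis by (auto simp: normal_inv_iff)
qed

text \<open>Kernels of representations are normal, which gives one direction. Conversely, a normal
  subgroup containing just one of \<open>g\<close> and \<open>h\<close> yields an irreducible
  representation that is trivial on that one only.\<close>

lemma E_set_eq_iff_normal_closure_eq:
  assumes G: "group G" and fin: "finite (carrier G)" and gh: "g \<in> carrier G" "h \<in> carrier G"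
  shows "E_set G h = E_set G g \<longleftrightarrow> normal_closure G h = normal_closure G g"
  unfolding E_set_eq_iff[OF assms] normal_closure_eq_iff[OF G gh]
proof
  assume same: "\<forall>n \<rho>. irreducible_representation G n \<rho> \<longrightarrow> (\<rho> h = 1\<^sub>m n \<longleftrightarrow> \<rho> g = 1\<^sub>m n)"
  have "h \<in> N \<longleftrightarrow> g \<in> N" if N: "N \<lhd> G" for N
    using same irreducible_representation_separates[OF G fin N gh(1)]
      irreducible_representation_separates[OF G fin N gh(2)] by blast
  then show "\<forall>N. N \<lhd> G \<longrightarrow> (h \<in> N \<longleftrightarrow> g \<in> N)" by blast
next
  assume same: "\<forall>N. N \<lhd> G \<longrightarrow> (h \<in> N \<longleftrightarrow> g \<in> N)"
  have "\<rho> h = 1\<^sub>m n \<longleftrightarrow> \<rho> g = 1\<^sub>m n" if "irreducible_representation G n \<rho>" for n \<rho>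
  proof -
    have "{x \<in> carrier G. \<rho> x = 1\<^sub>m n} \<lhd> G"
      using that representation_kernel_normal[OF G] by (simp add: irreducible_representation_def)
    with same gh show ?thesis by blast
  qed
  then show "\<forall>n \<rho>. irreducible_representation G n \<rho> \<longrightarrow> (\<rho> h = 1\<^sub>m n \<longleftrightarrow> \<rho> g = 1\<^sub>m n)"
    by blast
qed

section \<open>Conjugacy classes and the sets \<open>K_set G g\<close>\<close>

lemma conjugacy_class_eq:
  assumes "g \<in> carrier G"
  shows "conjugacy_class G g = {x \<otimes>\<^bsub>G\<^esub> g \<otimes>\<^bsub>G\<^esub> inv\<^bsub>G\<^esub> x | x. x \<in> carrier G}"
  using assms by (auto simp: conjugacy_class_def orbit_def)

text \<open>Normal subgroups are unions of conjugacy classes, so conjugate elements lie in the same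
  ones.\<close>

lemma normal_closure_conjugate:
  assumes G: "group G" and xg: "x \<in> carrier G" "g \<in> carrier G"
  shows "normal_closure G (x \<otimes>\<^bsub>G\<^esub> g \<otimes>\<^bsub>G\<^esub> inv\<^bsub>G\<^esub> x) = normal_closure G g"
proof -
  interpret group G by fact
  let ?h = "x \<otimes>\<^bsub>G\<^esub> g \<otimes>\<^bsub>G\<^esub> inv\<^bsub>G\<^esub> x"
  have "?h \<in> N \<longleftrightarrow> g \<in> N" if N: "N \<lhd> G" for N
  proof
    assume "?h \<in> N"
    \<comment> \<open>Conjugating back by the inverse of \<open>x\<close> recovers
      \<open>g\<close>.\<close>
    then have "inv\<^bsub>G\<^esub> x \<otimes>\<^bsub>G\<^esub> ?h \<otimes>\<^bsub>G\<^esub> inv\<^bsub>G\<^esub> (inv\<^bsub>G\<^esub> x) \<in> N"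
      using N xg unfolding normal_inv_iff by blast
    moreover have "inv\<^bsub>G\<^esub> x \<otimes>\<^bsub>G\<^esub> ?h \<otimes>\<^bsub>G\<^esub> inv\<^bsub>G\<^esub> (inv\<^bsub>G\<^esub> x) = g"
      using xg by (simp add: m_assoc[symmetric]) (simp add: m_assoc)
    ultimately show "g \<in> N" by simp
  qed (use N xg in \<open>simp add: normal_inv_iff\<close>)
  then show ?thesis using xg by (simp add: normal_closure_eq_iff[OF G])
qed

text \<open>Normal closure is constant on conjugacy classes, so forming the union of classes adds
  nothing to the fibre through \<open>g\<close>.\<close>

lemma K_set_eq_normal_interior:
  assumes G: "group G" and fin: "finite (carrier G)" and g: "g \<in> carrier G"
  shows "K_set G g = normal_interior G (normal_closure G g)"
proof -
  interpret group G by fact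
  have "K_set G g = {h \<in> carrier G. normal_closure G h = normal_closure G g}"
  proof (intro subset_antisym subsetI)
    fix y assume "y \<in> K_set G g"
    then obtain h x where hx: "h \<in> carrier G" "E_set G h = E_set G g" "x \<in> carrier G"
      "y = x \<otimes>\<^bsub>G\<^esub> h \<otimes>\<^bsub>G\<^esub> inv\<^bsub>G\<^esub> x"
      by (auto simp: K_set_def conjugacy_class_eq)
    then show "y \<in> {h \<in> carrier G. normal_closure G h = normal_closure G g}"
      using E_set_eq_iff_normal_closure_eq[OF G fin g] normal_closure_conjugate[OF G] by simp
  next
    fix h assume "h \<in> {h \<in> carrier G. normal_closure G h = normal_closure G g}"
    then have h: "h \<in> carrier G" "E_set G h = E_set G g"
      using E_set_eq_iff_normal_closure_eq[OF G fin g] by auto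
    have "h = \<one>\<^bsub>G\<^esub> \<otimes>\<^bsub>G\<^esub> h \<otimes>\<^bsub>G\<^esub> inv\<^bsub>G\<^esub> \<one>\<^bsub>G\<^esub>" using h by simp
    then have "h \<in> conjugacy_class G h"
      unfolding conjugacy_class_eq[OF h(1)] by blast
    with h show "h \<in> K_set G g" by (auto simp: K_set_def)
  qed
  also have "\<dots> = normal_interior G (normal_closure G g)"
    using mem_normal_interior_iff[OF G normal_closure_normal[OF G g]] by auto
  finally show ?thesis .
qed

theorem corollary4p3:
  fixes G :: "('a, 'b) monoid_scheme"
  assumes "group G" and "finite (carrier G)"
  shows "finest_normal_superclasses G = {K_set G g | g. g \<in> carrier G}"
proof (intro subset_antisym subsetI)
  fix X assume "X \<in> finest_normal_superclasses G"
  \<comment> \<open>Any element \<open>g\<close> of the nonempty interior has normal closure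
    \<open>N\<close> and so serves as the representative.\<close>
  then obtain N g where N: "N \<lhd> G" "X = normal_interior G N" and g: "g \<in> normal_interior G N"
    by (auto simp: finest_normal_superclasses_def normal_subgroups_def)
  then have "g \<in> carrier G" "normal_closure G g = N"
    using mem_normal_interior_iff[OF assms(1)] by blast+
  with N K_set_eq_normal_interior[OF assms] show "X \<in> {K_set G g | g. g \<in> carrier G}" by blast
next
  fix X assume "X \<in> {K_set G g | g. g \<in> carrier G}"
  then obtain g where g: "g \<in> carrier G" "X = normal_interior G (normal_closure G g)"
    using K_set_eq_normal_interior[OF assms] by blast
  note normal = normal_closure_normal[OF assms(1) g(1)]
  \<comment> \<open>This supplies the nonemptiness demanded of a superclass.\<close>
  have "g \<in> X"
    using g mem_normal_interior_iff[OF assms(1) normal] by blast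
  with g normal show "X \<in> finest_normal_superclasses G"
    by (auto simp: finest_normal_superclasses_def normal_subgroups_def)
qed

end
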